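(* Let $k$ be a field of characteristic zero, let $A$ be the Grossman-Larson Hopf algebra of rooted trees over $k$, with unit $e$ (the one-vertex tree), and let $N:A\to A$ be the natural growth operator. Then: (1) $N(e)b=N(b)$ for all $b\in A$. (2) $N(ab)=N(a)b$ for all $a,b\in A$. (3) $N^k(e)b=N^k(b)$ for all integers $k\geq 1$ and all $b\in A$. (4) $N^k(e)N(e)=N^{k+1}(e)=N(e)N^k(e)$ for all integers $k\geq 1$. (5) $N$ is a coderivation, that is, for all $b\in A$, $\Delta(N(b))=(\mathrm{id}\otimes N+N\otimes \mathrm{id})(\Delta(b))$.
   Context: All algebras, linear spaces and tensor products are over the ground field $k$ (the letter $k$ in (3) and (4) is an integer exponent). A rooted tree is a finite, connected and simply-connected set of oriented edges and vertices with exactly one distinguished vertex with no incoming edges, the root; edges are oriented away from the root, and trees are considered up to isomorphism (no ordering of children, no labels). The children of a vertex $v$ are the endpoints of the edges outgoing from $v$. All trees are non-empty; $e$ denotes the rooted tree with only one vertex. The Hopf algebra $A$: as a vector space it has a basis consisting of all rooted trees. The unit is $e$. Product: for rooted trees $t_1,t_2$, let $s_1,\dots,s_r$ be the children of the root of $t_1$ and $n$ the number of vertices of $t_2$; there are $n^r$ ways to attach the $r$ subtrees of $t_1$ with roots $s_1,\dots,s_r$ to $t_2$ by making each $s_i$ a child of some vertex of $t_2$ (the root of the result being the root of $t_2$); $t_1t_2$ is the sum of these $n^r$ rooted trees (with multiplicity). Coproduct: if $t$ is a rooted tree whose root has children $s_1,\dots,s_r$, then $\Delta(t)$ is the sum of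 the $2^r$ terms $t_1\otimes t_2$, where the children of the root of $t_1$ and the children of the root of $t_2$ (together with the subtrees they carry) range over all $2^r$ ordered partitions of $\{s_1,\dots,s_r\}$ into two (possibly empty) subsets; $\Delta(e)=e\otimes e$. Counit: $\varepsilon(e)=1$, $\varepsilon(t)=0$ for $t\neq e$. It is known that $A$ is a graded connected cocommutative Hopf algebra. Natural growth operator: $N:A\to A$ is the linear map such that, for any rooted tree $t$ with $n$ vertices, $N(t)$ is the sum (with multiplicity) of the $n$ rooted trees obtained from $t$ by attaching one more outgoing edge and vertex to each vertex of $t$ in turn (the root remaining the same). In particular $N(e)$ is the rooted tree with two vertices. $N^k$ denotes the $k$-fold composition. *)

theory Defs
  imports Main "HOL-Library.Multiset" "HOL-Library.FuncSet" "HOL-Library.Poly_Mapping"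
begin

section \<open>Rooted trees\<close>

text \<open>
  A rooted tree up to isomorphism is determined by the multiset of the (isomorphism classes of)
  subtrees carried by the children of its root; the children are not ordered.
\<close>

datatype rtree = Node (branches: "rtree multiset")

definition leaf :: rtree where
  "leaf = Node {#}"

text \<open>
  A branch may occur several times, so an individual child of the root of \<open>Node M\<close> is represented
  by a pair \<open>(c, j)\<close> with \<open>j < count M c\<close>: the \<open>j\<close>-th copy of the branch \<open>c\<close>. A vertex is
  represented by the list of children leading to it from the root, so the root is \<open>[]\<close>.
\<close>

type_synonym child = "rtree \<times> nat"
type_synonym vertex = "child list"

definition copies :: "rtree multiset \<Rightarrow> child set" where
  "copies M = (SIGMA c:set_mset M. {..<count M c})"

definition forest :: "child set \<Rightarrow> rtree multiset" where
  "forest S = image_mset fst (mset_set S)"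

lemma finite_copies [simp]: "finite (copies M)"
  by (simp add: copies_def)

lemma card_copies: "card (copies M) = size M"
  by (simp add: copies_def size_multiset_overloaded_eq)

lemma forest_copies: "forest (copies M) = M"
proof (rule multiset_eqI)
  fix x
  have "{p \<in> copies M. fst p = x} = (\<lambda>j. (x, j)) ` {..<count M x}"
    by (force simp: copies_def simp flip: count_greater_zero_iff)
  moreover have "card ((\<lambda>j. (x, j)) ` {..<count M x}) = count M x"
    by (subst card_image) (auto simp: inj_on_def)
  moreover have "count (forest (copies M)) x = card {p \<in> copies M. fst p = x}"
    by (auto simp: forest_def count_image_mset' sum.If_cases Int_def vimage_def conj_commute
        intro!: arg_cong[where f=card])
  ultimately show "count (forest (copies M)) x = count M x" by simp
qed

lemma size_branch: "(c, j) \<in> copies M \<Longrightarrow> size c < size (Node M)"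
  by (auto simp: copies_def dest!: multi_member_split)

function verts :: "rtree \<Rightarrow> vertex set" where
  "verts (Node M) = insert [] (\<Union>p\<in>copies M. (#) p ` verts (fst p))"
  by pat_completeness auto
termination
  by (relation "measure size") (auto dest: size_branch)

text \<open>
  \<open>attach F t\<close> is \<open>t\<close> with, at every vertex \<open>v\<close> of \<open>t\<close>, the roots of the trees in \<open>F v\<close>
  added to the children of \<open>v\<close>.
\<close>

function attach :: "(vertex \<Rightarrow> rtree multiset) \<Rightarrow> rtree \<Rightarrow> rtree" where
  "attach F (Node M) =
     Node (F [] + image_mset (\<lambda>p. attach (\<lambda>v. F (p # v)) (fst p)) (mset_set (copies M)))"
  by pat_completeness auto
termination
  by (relation "measure (\<lambda>(F, t). size t)") (auto dest: size_branch)

lemma finite_verts [simp]: "finite (verts t)"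
  by (induction t rule: verts.induct) auto

lemma attach_empty: "attach (\<lambda>_. {#}) t = t"
proof (induction t rule: verts.induct)
  case (1 M)
  have "image_mset (\<lambda>p. attach (\<lambda>v. {#}) (fst p)) (mset_set (copies M)) = forest (copies M)"
    unfolding forest_def by (rule image_mset_cong) (use 1 in auto)
  then show ?case by (simp add: forest_copies)
qed


section \<open>Linear structure\<close>

text \<open>
  The space with basis \<open>'b\<close> is the type \<open>'b \<Rightarrow>\<^sub>0 'k\<close> of finitely supported functions, and
  \<open>A \<otimes> A\<close> is the space whose basis consists of the pairs of rooted trees, \<open>(s, t)\<close> standing
  for \<open>s \<otimes> t\<close>. The convolution product that the library puts on \<open>'b \<Rightarrow>\<^sub>0 'k\<close> for
  monoids \<open>'b\<close> plays no role.
\<close>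

type_synonym 'k gl = "rtree \<Rightarrow>\<^sub>0 'k"
type_synonym 'k gl2 = "(rtree \<times> rtree) \<Rightarrow>\<^sub>0 'k"

definition basis :: "'b \<Rightarrow> ('b \<Rightarrow>\<^sub>0 'k::field)" where
  "basis b = Poly_Mapping.single b 1"

definition scale :: "'k::field \<Rightarrow> ('b \<Rightarrow>\<^sub>0 'k) \<Rightarrow> ('b \<Rightarrow>\<^sub>0 'k)" where
  "scale c x = Poly_Mapping.map ((*) c) x"

definition lin_ext :: "('b \<Rightarrow> ('c \<Rightarrow>\<^sub>0 'k)) \<Rightarrow> ('b \<Rightarrow>\<^sub>0 'k::field) \<Rightarrow> ('c \<Rightarrow>\<^sub>0 'k)" where
  "lin_ext f x = (\<Sum>b\<in>Poly_Mapping.keys x. scale (Poly_Mapping.lookup x b) (f b))"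

definition tensor :: "'k::field gl \<Rightarrow> 'k gl \<Rightarrow> 'k gl2" (infixr "\<otimes>" 75) where
  "a \<otimes> b = (\<Sum>s\<in>Poly_Mapping.keys a. \<Sum>t\<in>Poly_Mapping.keys b.
     Poly_Mapping.single (s, t) (Poly_Mapping.lookup a s * Poly_Mapping.lookup b t))"

definition tensor_map ::
    "('k::field gl \<Rightarrow> 'k gl) \<Rightarrow> ('k gl \<Rightarrow> 'k gl) \<Rightarrow> 'k gl2 \<Rightarrow> 'k gl2" where
  "tensor_map f g = lin_ext (\<lambda>(s, t). f (basis s) \<otimes> g (basis t))"


section \<open>The Grossman-Larson Hopf algebra and natural growth\<close>

definition unit_gl :: "'k::field gl" ("\<e>") where
  "\<e> = basis leaf"

text \<open>
  The maps \<open>\<phi>\<close> below choose, for each child of the root of \<open>s\<close>, the vertex of \<open>t\<close> to which it is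
  attached.
\<close>

definition tree_mult :: "rtree \<Rightarrow> rtree \<Rightarrow> 'k::field gl" where
  "tree_mult s t = (\<Sum>\<phi> \<in> copies (branches s) \<rightarrow>\<^sub>E verts t.
     basis (attach (\<lambda>v. forest {p \<in> copies (branches s). \<phi> p = v}) t))"

definition gl_mult :: "'k::field gl \<Rightarrow> 'k gl \<Rightarrow> 'k gl" (infixl "\<bullet>" 70) where
  "a \<bullet> b = lin_ext (\<lambda>(s, t). tree_mult s t) (a \<otimes> b)"

definition tree_coprod :: "rtree \<Rightarrow> 'k::field gl2" where
  "tree_coprod t = (\<Sum>S \<in> Pow (copies (branches t)).
     basis (Node (forest S)) \<otimes> basis (Node (forest (copies (branches t) - S))))"

definition coprod :: "'k::field gl \<Rightarrow> 'k gl2" ("\<Delta>") where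
  "\<Delta> = lin_ext tree_coprod"

definition tree_growth :: "rtree \<Rightarrow> 'k::field gl" where
  "tree_growth t = (\<Sum>v \<in> verts t. basis (attach (\<lambda>u. if u = v then {#leaf#} else {#}) t))"

definition growth :: "'k::field gl \<Rightarrow> 'k gl" ("\<N>") where
  "\<N> = lin_ext tree_growth"

end

(* Everything reduces to trees by linearity. The vertices of a product tree arising from s and t are
   those of t together with the non-root vertices of s. A new leaf at a vertex of t corresponds to
   growing s at its root and attaching the new branch at that vertex; a new leaf at a vertex of a
   branch of s corresponds to growing s there. Hence N(st) = N(s)t, and taking the unit for s gives
   N(t) = N(e)t; the formulas for the powers follow.
   For the coproduct, a new leaf at the root is a new branch that goes to either tensor factor, and
   a new leaf further down grows one branch, hence the factor that contains it. *)
theory Submission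
  imports Defs "HOL.Vector_Spaces"
begin

section \<open>Linear extension\<close>

lemma lookup_scale [simp]: "Poly_Mapping.lookup (scale c x) b = c * Poly_Mapping.lookup x b"
  by (simp add: scale_def Poly_Mapping.map.rep_eq when_def)

lemma scale_single: "scale c (Poly_Mapping.single b d) = Poly_Mapping.single b (c * d)"
  by (rule poly_mapping_eqI) (simp add: lookup_single when_def)

interpretation scale: vector_space scale
  by standard (auto intro!: poly_mapping_eqI simp: lookup_add algebra_simps)

interpretation scale: vector_space_pair scale scale ..

abbreviation lin :: "(('b \<Rightarrow>\<^sub>0 'k::field) \<Rightarrow> ('c \<Rightarrow>\<^sub>0 'k)) \<Rightarrow> bool" where
  "lin \<equiv> Vector_Spaces.linear scale scale"

lemma basis_expansion:
  "x = (\<Sum>b\<in>Poly_Mapping.keys x. scale (Poly_Mapping.lookup x b) (basis b))"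
  by (rule poly_mapping_eqI)
    (auto simp: lookup_sum basis_def lookup_single when_def in_keys_iff sum.delta
      if_distrib cong: if_cong)

text \<open>Padding with zero coefficients lets \<open>x\<close>, \<open>y\<close> and
  \<open>x + y\<close> be summed over one index set; cancellation can make the keys of the sum
  smaller.\<close>

lemma lin_ext_superset:
  assumes "finite B" "Poly_Mapping.keys x \<subseteq> B"
  shows "lin_ext f x = (\<Sum>b\<in>B. scale (Poly_Mapping.lookup x b) (f b))"
  unfolding lin_ext_def
  by (rule sum.mono_neutral_left) (use assms in \<open>auto simp: in_keys_iff\<close>)

lemma lin_lin_ext: "lin (lin_ext f)"
proof -
  have "lin_ext f (x + y) = lin_ext f x + lin_ext f y" for x y
  proof -
    let ?B = "Poly_Mapping.keys x \<union> Poly_Mapping.keys y"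
    have "lin_ext f (x + y) = (\<Sum>b\<in>?B. scale (Poly_Mapping.lookup (x + y) b) (f b))"
      by (rule lin_ext_superset) (use keys_add[of x y] in auto)
    also have "\<dots> = lin_ext f x + lin_ext f y"
      by (simp add: lin_ext_superset[of ?B] lookup_add scale.scale_left_distrib sum.distrib)
    finally show ?thesis .
  qed
  moreover have "lin_ext f (scale c x) = scale c (lin_ext f x)" for c x
  proof -
    have "lin_ext f (scale c x) =
        (\<Sum>b\<in>Poly_Mapping.keys x. scale (Poly_Mapping.lookup (scale c x) b) (f b))"
      by (rule lin_ext_superset) (auto simp: in_keys_iff)
    then show ?thesis
      by (simp add: lin_ext_def scale.scale_sum_right)
  qed
  ultimately show ?thesis
    by (simp add: linear_iff scale.vector_space_axioms)
qed

lemma lin_ext_basis [simp]: "lin_ext f (basis b) = f b"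
  by (simp add: lin_ext_def basis_def)

text \<open>Linear maps are determined by the basis. This rule carries the identities from trees to
  the whole algebra.\<close>

lemma lin_eqI:
  assumes "lin f" "lin g" "\<And>b. f (basis b) = g (basis b)"
  shows "f x = g x"
  by (subst (1 2) basis_expansion[of x])
    (simp add: assms scale.linear_sum scale.linear_scale)

section \<open>Bilinearity of the tensor product and linearity of the operations\<close>

lemma tensor_basis [simp]: "basis s \<otimes> basis t = basis (s, t)"
  by (simp add: tensor_def basis_def)

text \<open>With one argument fixed, the double sum is a linear extension in the other, so
  bilinearity follows from \<open>lin_lin_ext\<close>.\<close>

lemma tensor_eq_lin_ext_left: "a \<otimes> b = lin_ext (\<lambda>s. basis s \<otimes> b) a"
  by (simp add: tensor_def lin_ext_def basis_def scale.scale_sum_right scale_single)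

lemma tensor_eq_lin_ext_right: "a \<otimes> b = lin_ext (\<lambda>t. a \<otimes> basis t) b"
  unfolding tensor_def lin_ext_def
  by (subst sum.swap) (simp add: basis_def scale.scale_sum_right scale_single mult.commute)

lemma lin_tensor_left: "lin (\<lambda>a. a \<otimes> b)"
  by (subst tensor_eq_lin_ext_left[abs_def]) (rule lin_lin_ext)

lemma lin_tensor_right: "lin (\<lambda>b. a \<otimes> b)"
  by (subst tensor_eq_lin_ext_right[abs_def]) (rule lin_lin_ext)

lemma lin_comp: "lin f \<Longrightarrow> lin g \<Longrightarrow> lin (\<lambda>x. g (f x))"
  using Vector_Spaces.linear_compose[of scale scale f scale g] by (simp add: o_def)

lemma lin_mult_left: "lin (\<lambda>a. a \<bullet> b)"
  unfolding gl_mult_def by (rule lin_comp[OF lin_tensor_left lin_lin_ext])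

lemma lin_mult_right: "lin (\<lambda>b. a \<bullet> b)"
  unfolding gl_mult_def by (rule lin_comp[OF lin_tensor_right lin_lin_ext])

lemma lin_growth: "lin \<N>"
  unfolding growth_def by (rule lin_lin_ext)

lemma lin_coprod: "lin \<Delta>"
  unfolding coprod_def by (rule lin_lin_ext)

lemma lin_tensor_map: "lin (tensor_map f g)"
  unfolding tensor_map_def by (rule lin_lin_ext)


section \<open>Growth of a tree\<close>

text \<open>For \<open>f = basis\<close> this is the growth of the tree. A general \<open>f\<close>
  allows products and coproducts of grown trees, or grown branches put back in their context, to be
  summed by the same rules.\<close>

definition growth_sum :: "(rtree \<Rightarrow> 'a::comm_monoid_add) \<Rightarrow> rtree \<Rightarrow> 'a" where
  "growth_sum f t = (\<Sum>v\<in>verts t. f (attach (\<lambda>u. if u = v then {#leaf#} else {#}) t))"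

lemma lin_tree_growth: "lin L \<Longrightarrow> L (tree_growth t) = growth_sum (\<lambda>s. L (basis s)) t"
  by (simp add: tree_growth_def growth_sum_def scale.linear_sum)

lemma growth_sum_sum: "growth_sum (\<lambda>s. \<Sum>i\<in>I. f i s) t = (\<Sum>i\<in>I. growth_sum (f i) t)"
  unfolding growth_sum_def by (rule sum.swap)

lemma sum_copies: "(\<Sum>p\<in>copies M. f (fst p)) = (\<Sum>c\<in>#M. f c)"
proof -
  have "(\<Sum>c\<in>#M. f c) = (\<Sum>c\<in>#forest (copies M). f c)"
    by (simp add: forest_copies)
  then show ?thesis
    by (simp add: forest_def sum_unfold_sum_mset multiset.map_comp o_def)
qed

lemma image_mset_fun_upd:
  assumes "finite I" "i \<in> I"
  shows "image_mset (c(i := x)) (mset_set I) = add_mset x (image_mset c (mset_set I) - {#c i#})"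
proof -
  have "image_mset (c(i := x)) (mset_set (I - {i})) = image_mset c (mset_set (I - {i}))"
    by (rule image_mset_cong) (use assms in auto)
  then show ?thesis
    by (simp add: mset_set.remove[OF assms])
qed

lemma sum_verts_Node:
  "(\<Sum>v\<in>verts (Node M). f v) = f [] + (\<Sum>p\<in>copies M. \<Sum>v\<in>verts (fst p). f (p # v))"
proof -
  have "(\<Sum>v\<in>verts (Node M). f v) = f [] + (\<Sum>v\<in>(\<Union>p\<in>copies M. (#) p ` verts (fst p)). f v)"
    by (simp add: image_iff)
  also have "(\<Sum>v\<in>(\<Union>p\<in>copies M. (#) p ` verts (fst p)). f v) =
      (\<Sum>p\<in>copies M. \<Sum>v\<in>(#) p ` verts (fst p). f v)"
    by (rule sum.UNION_disjoint) auto
  finally show ?thesis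
    by (simp add: sum.reindex)
qed

lemma attach_fun_upd_root:
  "attach (F([] := A)) (Node M) =
    Node (A + image_mset (\<lambda>p. attach (\<lambda>v. F (p # v)) (fst p)) (mset_set (copies M)))"
  by simp

text \<open>The update is visible only in the branch \<open>p\<close>, where it becomes an update at
  \<open>v\<close>.\<close>

lemma attach_fun_upd_branch:
  assumes "p \<in> copies M"
  shows "attach (F(p # v := A)) (Node M) =
    Node (F [] + image_mset ((\<lambda>p. attach (\<lambda>v. F (p # v)) (fst p))
      (p := attach ((\<lambda>v. F (p # v))(v := A)) (fst p))) (mset_set (copies M)))"
proof -
  have "attach (\<lambda>u. (F(p # v := A)) (q # u)) (fst q) = ((\<lambda>p. attach (\<lambda>v. F (p # v)) (fst p))
      (p := attach ((\<lambda>v. F (p # v))(v := A)) (fst p))) q" for q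
    by (auto simp: fun_upd_def)
  then show ?thesis
    by (simp del: fun_upd_apply)
       (simp add: fun_upd_def)
qed

text \<open>The root receives the leaf, or a vertex of one branch does. Stated with multisets, this
  recursion eliminates paths and counts equal branches with multiplicity.\<close>

lemma growth_sum_Node:
  "growth_sum f (Node M) = f (Node (add_mset leaf M)) +
     (\<Sum>c\<in>#M. growth_sum (\<lambda>c'. f (Node (add_mset c' (M - {#c#})))) c)"
proof -
  have upd: "(\<lambda>u. if u = v then A else {#}) = (\<lambda>_. {#})(v := A)" for v :: vertex and A :: "rtree multiset"
    by auto
  have eq: "image_mset fst (mset_set (copies M)) = M"
    using forest_copies[of M] by (simp add: forest_def)
  have "(\<Sum>v\<in>verts (fst p). f (attach ((\<lambda>_. {#})(p # v := {#leaf#})) (Node M))) =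
      growth_sum (\<lambda>c'. f (Node (add_mset c' (M - {#fst p#})))) (fst p)"
    if "p \<in> copies M" for p
    using that
    by (simp add: growth_sum_def attach_fun_upd_branch attach_empty image_mset_fun_upd upd eq
        del: attach.simps)
  then show ?thesis
    by (simp add: growth_sum_def[of f] upd sum_verts_Node attach_fun_upd_root attach_empty eq
        flip: sum_copies del: attach.simps verts.simps)
qed

text \<open>In \<open>attach\<close>, the root carries new branches \<open>A\<close> beside the old
  ones, which are indexed by \<open>I\<close>. Growth at the root or in \<open>A\<close> is
  collected as growth of \<open>Node A\<close>; what remains is growth in an indexed branch.\<close>

lemma growth_sum_Node_union:
  assumes "finite I"
  shows "growth_sum f (Node (A + image_mset c (mset_set I))) =
    growth_sum (\<lambda>s. f (Node (branches s + image_mset c (mset_set I)))) (Node A) +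
    (\<Sum>i\<in>I. growth_sum (\<lambda>c'. f (Node (A + image_mset (c(i := c')) (mset_set I)))) (c i))"
proof -
  let ?K = "image_mset c (mset_set I)"
  \<comment> \<open>Here \<open>x\<close> belongs to \<open>A\<close>, so its removal commutes with
    adding \<open>?K\<close>.\<close>
  have "(\<Sum>x\<in>#A. growth_sum (\<lambda>c'. f (Node (add_mset c' (A + ?K - {#x#})))) x) =
        (\<Sum>x\<in>#A. growth_sum (\<lambda>c'. f (Node (add_mset c' (A - {#x#} + ?K)))) x)"
    by (intro arg_cong[where f = sum_mset] image_mset_cong) simp
  moreover have "(\<Sum>x\<in>#?K. growth_sum (\<lambda>c'. f (Node (add_mset c' (A + ?K - {#x#})))) x) =
    (\<Sum>i\<in>I. growth_sum (\<lambda>c'. f (Node (A + image_mset (c(i := c')) (mset_set I)))) (c i))"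
    unfolding sum_unfold_sum_mset multiset.map_comp o_def
    by (intro arg_cong[where f = sum_mset] image_mset_cong)
       (use assms in \<open>simp add: image_mset_fun_upd\<close>)
  ultimately show ?thesis
    by (simp add: growth_sum_Node add.assoc)
qed

text \<open>
  Growing the auxiliary tree \<open>Node (F v)\<close> at its root puts the new leaf at \<open>v\<close> itself; growing it
  elsewhere puts the leaf into one of the trees attached at \<open>v\<close>.
\<close>

lemma growth_sum_attach:
  fixes f :: "rtree \<Rightarrow> 'a::comm_monoid_add"
  shows "growth_sum f (attach F t) =
    (\<Sum>v\<in>verts t. growth_sum (\<lambda>s. f (attach (F(v := branches s)) t)) (Node (F v)))"
proof (induction t arbitrary: f F rule: verts.induct)
  case (1 M)
  let ?c = "\<lambda>p. attach (\<lambda>v. F (p # v)) (fst p)"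
  \<comment> \<open>The induction hypothesis is used for maps \<open>g\<close> other than
    \<open>f\<close>: a grown branch is put back among its siblings before \<open>f\<close> is
    applied.\<close>
  have "growth_sum g (?c p) = (\<Sum>v\<in>verts (fst p). growth_sum
     (\<lambda>s. g (attach ((\<lambda>v. F (p # v))(v := branches s)) (fst p))) (Node (F (p # v))))"
    if "p \<in> copies M" for g :: "rtree \<Rightarrow> 'a" and p
    by (rule 1[OF that])
  then have "growth_sum f (attach F (Node M)) =
    growth_sum (\<lambda>s. f (attach (F([] := branches s)) (Node M))) (Node (F [])) +
    (\<Sum>p\<in>copies M. \<Sum>v\<in>verts (fst p).
      growth_sum (\<lambda>s. f (attach (F(p # v := branches s)) (Node M))) (Node (F (p # v))))"
    by (simp add: attach.simps[of F M] growth_sum_Node_union attach_fun_upd_root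
        attach_fun_upd_branch del: fun_upd_apply attach.simps)
  then show ?case
    by (simp add: sum_verts_Node fun_upd_def del: attach.simps verts.simps)
qed


section \<open>Indexing branches by other finite sets\<close>

text \<open>
  After growth, \<open>copies\<close> of the new multiset of branches bears no canonical relation to the old
  one: the changed branch may coincide with others, which shifts the numbering. Product and
  coproduct are therefore expressed through arbitrary index sets for the branches.
\<close>

lemma copies_reindex:
  assumes "finite I" "image_mset c (mset_set I) = M"
  obtains h where "bij_betw h I (copies M)" "\<And>i. i \<in> I \<Longrightarrow> fst (h i) = c i"
proof -
  \<comment> \<open>Each fibre of \<open>c\<close> is numbered separately; it has as many elements
    as the branch has copies.\<close>
  have "\<exists>g. bij_betw g {i \<in> I. c i = x} {..<count M x}" for x
  proof -
    have "card {i \<in> I. c i = x} = count M x"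
      using assms by (auto simp: count_image_mset' sum.If_cases Int_def conj_commute
          intro!: arg_cong[where f = card])
    then show ?thesis
      using ex_bij_betw_finite_nat[of "{i \<in> I. c i = x}"] assms(1)
      by (simp add: atLeast0LessThan)
  qed
  then obtain g where g: "\<And>x. bij_betw (g x) {i \<in> I. c i = x} {..<count M x}"
    by metis
  \<comment> \<open>Pairing a branch with the number inside its fibre gives the bijection.\<close>
  have "inj_on (\<lambda>i. (c i, g (c i) i)) I"
    using g unfolding bij_betw_def inj_on_def by auto
  moreover have "(\<lambda>i. (c i, g (c i) i)) ` I = copies M"
  proof (intro subset_antisym subsetI)
    fix p assume "p \<in> copies M"
    then obtain x j where p: "p = (x, j)" "j \<in> {..<count M x}"
      by (auto simp: copies_def)
    then have "j \<in> g x ` {i \<in> I. c i = x}"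
      using g[of x] by (auto simp: bij_betw_def)
    then show "p \<in> (\<lambda>i. (c i, g (c i) i)) ` I"
      using p by auto
  next
    fix p assume "p \<in> (\<lambda>i. (c i, g (c i) i)) ` I"
    then obtain i where i: "i \<in> I" "p = (c i, g (c i) i)"
      by auto
    then have "g (c i) i \<in> {..<count M (c i)}"
      using g[of "c i"] by (auto simp: bij_betw_def)
    then show "p \<in> copies M"
      using i by (auto simp: copies_def simp flip: count_greater_zero_iff)
  qed
  ultimately show thesis
    by (intro that[of "\<lambda>i. (c i, g (c i) i)"]) (auto simp: bij_betw_def)
qed

lemma forest_image:
  assumes "inj_on h I" "\<And>i. i \<in> I \<Longrightarrow> fst (h i) = c i"
  shows "forest (h ` I) = image_mset c (mset_set I)"
proof (cases "finite I")
  case True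
  then show ?thesis
    using assms by (auto simp: forest_def multiset.map_comp
      intro!: image_mset_cong simp flip: image_mset_mset_set)
next
  case False
  then show ?thesis
    using assms by (simp add: forest_def finite_image_iff)
qed

text \<open>A bijection of index sets that preserves the branches matches choice maps by composition
  and keeps the forest attached at each vertex.\<close>

lemma tree_mult_reindex:
  assumes "finite I"
  shows "tree_mult (Node (image_mset c (mset_set I))) t =
    (\<Sum>\<phi> \<in> I \<rightarrow>\<^sub>E verts t. basis (attach (\<lambda>v. image_mset c (mset_set {i \<in> I. \<phi> i = v})) t))"
proof -
  define M where "M = image_mset c (mset_set I)"
  obtain h where h: "bij_betw h I (copies M)" "\<And>i. i \<in> I \<Longrightarrow> fst (h i) = c i"
    using copies_reindex[OF assms M_def[symmetric]] by blast
  define h' where "h' = inv_into I h"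
  have inv: "h i \<in> copies M" "h' (h i) = i" if "i \<in> I" for i
    using h(1) that by (auto simp: h'_def bij_betw_def)
  have inv': "h' p \<in> I" "h (h' p) = p" if "p \<in> copies M" for p
    using h(1) that by (auto simp: h'_def bij_betw_def inv_into_into f_inv_into_f)
  have "(\<Sum>\<phi> \<in> copies M \<rightarrow>\<^sub>E verts t. basis (attach (\<lambda>v. forest {p \<in> copies M. \<phi> p = v}) t)) =
    (\<Sum>\<phi> \<in> I \<rightarrow>\<^sub>E verts t. basis (attach (\<lambda>v. image_mset c (mset_set {i \<in> I. \<phi> i = v})) t))"
  \<comment> \<open>\<open>restrict\<close> returns the composites to the extensional function
    spaces, where values outside the domain are fixed.\<close>
  proof (rule sum.reindex_bij_witness[where i = "\<lambda>\<psi>. restrict (\<psi> \<circ> h') (copies M)"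
        and j = "\<lambda>\<phi>. restrict (\<phi> \<circ> h) I"])
    fix \<phi> assume \<phi>: "\<phi> \<in> copies M \<rightarrow>\<^sub>E verts t"
    have "forest {p \<in> copies M. \<phi> p = v} = image_mset c (mset_set {i \<in> I. restrict (\<phi> \<circ> h) I i = v})" for v
    proof -
      have "{p \<in> copies M. \<phi> p = v} = h ` {i \<in> I. restrict (\<phi> \<circ> h) I i = v}"
        using inv inv' by (auto simp: image_iff) metis
      then show ?thesis
        using h by (auto intro!: forest_image simp: bij_betw_def inj_on_def)
    qed
    then show "basis (attach (\<lambda>v. image_mset c (mset_set {i \<in> I. restrict (\<phi> \<circ> h) I i = v})) t) =
      basis (attach (\<lambda>v. forest {p \<in> copies M. \<phi> p = v}) t)" by simp
    show "restrict (restrict (\<phi> \<circ> h) I \<circ> h') (copies M) = \<phi>"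
      using \<phi> inv' by (auto simp: fun_eq_iff restrict_def PiE_def extensional_def)
    show "restrict (\<phi> \<circ> h) I \<in> I \<rightarrow>\<^sub>E verts t"
      using \<phi> inv by auto
  next
    fix \<psi> assume \<psi>: "\<psi> \<in> I \<rightarrow>\<^sub>E verts t"
    show "restrict (\<psi> \<circ> h') (copies M) \<in> copies M \<rightarrow>\<^sub>E verts t"
      using \<psi> inv' by auto
    show "restrict (restrict (\<psi> \<circ> h') (copies M) \<circ> h) I = \<psi>"
      using \<psi> inv by (auto simp: fun_eq_iff restrict_def PiE_def extensional_def)
  qed
  then show ?thesis
    by (simp add: tree_mult_def M_def)
qed

text \<open>A bijection of index sets carries subsets to subsets and complements to
  complements.\<close>

lemma tree_coprod_reindex:
  assumes "finite I"
  shows "tree_coprod (Node (image_mset c (mset_set I))) =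
    (\<Sum>S \<in> Pow I. basis (Node (image_mset c (mset_set S)), Node (image_mset c (mset_set (I - S)))))"
proof -
  define M where "M = image_mset c (mset_set I)"
  obtain h where h: "bij_betw h I (copies M)" "\<And>i. i \<in> I \<Longrightarrow> fst (h i) = c i"
    using copies_reindex[OF assms M_def[symmetric]] by blast
  have *: "forest (h ` S) = image_mset c (mset_set S)" if "S \<subseteq> I" for S
    using h that by (intro forest_image) (auto simp: bij_betw_def intro: inj_on_subset)
  have "(\<Sum>S \<in> Pow (copies M). basis (Node (forest S), Node (forest (copies M - S)))) =
    (\<Sum>S \<in> Pow I. basis (Node (forest (h ` S)), Node (forest (copies M - h ` S))))"
    by (rule sum.reindex_bij_betw[symmetric]) (rule bij_betw_Pow[OF h(1)])
  also have "\<dots> = (\<Sum>S \<in> Pow I. basis (Node (image_mset c (mset_set S)), Node (image_mset c (mset_set (I - S)))))"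
  proof (rule sum.cong)
    fix S assume S: "S \<in> Pow I"
    then have "copies M - h ` S = h ` (I - S)"
      using h(1) by (auto simp: bij_betw_def inj_on_image_set_diff[of h I])
    then show "basis (Node (forest (h ` S)), Node (forest (copies M - h ` S))) =
      basis (Node (image_mset c (mset_set S)), Node (image_mset c (mset_set (I - S))))"
      using S by (simp add: *)
  qed simp
  finally show ?thesis
    by (simp add: tree_coprod_def M_def)
qed


section \<open>Growth, product and coproduct\<close>

text \<open>Adding a branch, unlike replacing one, keeps the old numbering: the new copy takes the
  first free number.\<close>

lemma copies_add_mset:
  "copies (add_mset x M) = insert (x, count M x) (copies M)" "(x, count M x) \<notin> copies M"
  by (auto simp: copies_def not_in_iff split: if_splits)

lemma forest_insert:
  "finite S \<Longrightarrow> p \<notin> S \<Longrightarrow> forest (insert p S) = add_mset (fst p) (forest S)"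
  by (simp add: forest_def)

text \<open>Membership of \<open>p\<close> in \<open>S\<close> decides where a change of branch is
  seen. Below, \<open>S\<close> is the set of children attached at one vertex, or one side of a
  coproduct term.\<close>

lemma image_forest_fun_upd:
  assumes "finite S"
  shows "image_mset (fst(p := x)) (mset_set S) =
    (if p \<in> S then add_mset x (forest S - {#fst p#}) else forest S)"
proof (cases "p \<in> S")
  case False
  then show ?thesis
    using assms by (auto simp: forest_def intro!: image_mset_cong)
qed (use assms in \<open>simp add: image_mset_fun_upd forest_def\<close>)

lemma growth_sum_forest:
  assumes "finite S"
  shows "growth_sum f (Node (forest S)) = f (Node (add_mset leaf (forest S))) +
    (\<Sum>p\<in>S. growth_sum (\<lambda>c. f (Node (image_mset (fst(p := c)) (mset_set S)))) (fst p))"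
  using growth_sum_Node_union[OF assms, of f "{#}" fst]
  by (simp add: growth_sum_Node forest_def)

section \<open>Products of trees and growth of the left factor\<close>

lemma tree_mult_leaf: "tree_mult leaf t = basis t"
  by (simp add: tree_mult_def leaf_def copies_def forest_def attach_empty)

text \<open>A choice map for the larger set of children is an old choice map together with a vertex
  for the new child.\<close>

lemma tree_mult_add_mset:
  "tree_mult (Node (add_mset x M)) t = (\<Sum>\<phi> \<in> copies M \<rightarrow>\<^sub>E verts t. \<Sum>v\<in>verts t.
    basis (attach ((\<lambda>v. forest {p \<in> copies M. \<phi> p = v})
      (v := add_mset x (forest {p \<in> copies M. \<phi> p = v}))) t))"
proof -
  let ?P = "copies M" and ?q = "(x, count M x)"
  have *: "forest {p. (p = ?q \<or> p \<in> ?P) \<and> (\<phi>(?q := v)) p = u} =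
      ((\<lambda>v. forest {p \<in> ?P. \<phi> p = v}) (v := add_mset x (forest {p \<in> ?P. \<phi> p = v}))) u"
    for \<phi> v u
  proof -
    have "{p. (p = ?q \<or> p \<in> ?P) \<and> (\<phi>(?q := v)) p = u} =
      (if u = v then insert ?q {p \<in> ?P. \<phi> p = u} else {p \<in> ?P. \<phi> p = u})"
      using copies_add_mset(2)[of x M] by auto
    then show ?thesis
      using copies_add_mset(2)[of x M] by (simp add: forest_insert)
  qed
  have inj: "inj_on (\<lambda>(v, \<phi>). \<phi>(?q := v)) (verts t \<times> (?P \<rightarrow>\<^sub>E verts t))"
    using inj_combinator[OF copies_add_mset(2)[of x M], of "\<lambda>_. verts t"] .
  have "tree_mult (Node (add_mset x M)) t = (\<Sum>(v, \<phi>) \<in> verts t \<times> (?P \<rightarrow>\<^sub>E verts t).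
      basis (attach (\<lambda>u. forest {p. (p = ?q \<or> p \<in> ?P) \<and> (\<phi>(?q := v)) p = u}) t))"
    using sum.reindex[OF inj]
    by (simp add: tree_mult_def copies_add_mset(1) PiE_insert_eq case_prod_unfold o_def
        del: fun_upd_apply)
  also have "\<dots> = (\<Sum>\<phi> \<in> ?P \<rightarrow>\<^sub>E verts t. \<Sum>v\<in>verts t.
      basis (attach (\<lambda>u. forest {p. (p = ?q \<or> p \<in> ?P) \<and> (\<phi>(?q := v)) p = u}) t))"
    by (subst sum.swap) (simp add: sum.cartesian_product)
  finally show ?thesis
    unfolding * .
qed

lemma growth_tree_mult: "\<N> (tree_mult s t) = growth_sum (\<lambda>s. tree_mult s t) s"
proof (cases s)
  case (Node M)
  let ?P = "copies M" and ?V = "verts t"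
  let ?F = "\<lambda>\<phi> (v :: vertex). forest {p \<in> ?P. \<phi> p = v}"
  let ?g = "\<lambda>\<phi> v p. growth_sum (\<lambda>c. basis (attach
    ((?F \<phi>)(v := add_mset c (?F \<phi> v - {#fst p#}))) t)) (fst p)"
  have "\<N> (tree_mult s t) = (\<Sum>\<phi> \<in> ?P \<rightarrow>\<^sub>E ?V. growth_sum basis (attach (?F \<phi>) t))"
    by (simp add: Node tree_mult_def scale.linear_sum[OF lin_growth])
      (simp add: growth_def tree_growth_def growth_sum_def)
  \<comment> \<open>Growing the forest at \<open>v\<close> either adds a leaf there or grows one
    branch \<open>p\<close> attached to \<open>v\<close>.\<close>
  also have "\<dots> = (\<Sum>\<phi> \<in> ?P \<rightarrow>\<^sub>E ?V. \<Sum>v\<in>?V.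
      basis (attach ((?F \<phi>)(v := add_mset leaf (?F \<phi> v))) t) +
      (\<Sum>p\<in>{p \<in> ?P. \<phi> p = v}. ?g \<phi> v p))"
    by (subst growth_sum_attach)
      (simp add: growth_sum_Node forest_def sum_unfold_sum_mset multiset.map_comp o_def)
  \<comment> \<open>An old choice map with a vertex for the leaf is a choice map for
    \<open>s\<close> grown at its root.\<close>
  also have "\<dots> = tree_mult (Node (add_mset leaf M)) t +
      (\<Sum>\<phi> \<in> ?P \<rightarrow>\<^sub>E ?V. \<Sum>v\<in>?V. \<Sum>p\<in>{p \<in> ?P. \<phi> p = v}. ?g \<phi> v p)"
    by (simp add: sum.distrib tree_mult_add_mset)
  \<comment> \<open>Each child \<open>p\<close> lies over exactly one vertex,
    \<open>\<phi> p\<close>, so the sum over vertices disappears.\<close>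
  also have "(\<Sum>\<phi> \<in> ?P \<rightarrow>\<^sub>E ?V. \<Sum>v\<in>?V. \<Sum>p\<in>{p \<in> ?P. \<phi> p = v}. ?g \<phi> v p) =
      (\<Sum>\<phi> \<in> ?P \<rightarrow>\<^sub>E ?V. \<Sum>p\<in>?P. ?g \<phi> (\<phi> p) p)"
  proof (rule sum.cong)
    fix \<phi> assume "\<phi> \<in> ?P \<rightarrow>\<^sub>E ?V"
    then have "(\<Sum>v\<in>?V. \<Sum>p\<in>{p \<in> ?P. \<phi> p = v}. ?g \<phi> (\<phi> p) p) = (\<Sum>p\<in>?P. ?g \<phi> (\<phi> p) p)"
      by (intro sum.group) auto
    then show "(\<Sum>v\<in>?V. \<Sum>p\<in>{p \<in> ?P. \<phi> p = v}. ?g \<phi> v p) = (\<Sum>p\<in>?P. ?g \<phi> (\<phi> p) p)"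
      by simp
  qed simp
  also have "\<dots> = (\<Sum>p\<in>?P. growth_sum (\<lambda>c. \<Sum>\<phi> \<in> ?P \<rightarrow>\<^sub>E ?V. basis (attach
      ((?F \<phi>)(\<phi> p := add_mset c (?F \<phi> (\<phi> p) - {#fst p#}))) t)) (fst p))"
    by (subst sum.swap) (simp add: growth_sum_sum)
  \<comment> \<open>Only the forest at \<open>\<phi> p\<close> contains the child \<open>p\<close>.
    Keeping \<open>?P\<close> as index set lets the same \<open>\<phi>\<close> serve for the grown
    tree.\<close>
  also have "\<dots> = (\<Sum>p\<in>?P. growth_sum (\<lambda>c.
      tree_mult (Node (image_mset (fst(p := c)) (mset_set ?P))) t) (fst p))"
  proof (rule sum.cong)
    fix p assume "p \<in> ?P"
    then have "(?F \<phi>)(\<phi> p := add_mset c (?F \<phi> (\<phi> p) - {#fst p#})) =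
        (\<lambda>v. image_mset (fst(p := c)) (mset_set {p \<in> ?P. \<phi> p = v}))" for \<phi> c
      by (auto simp: fun_eq_iff image_forest_fun_upd)
    then show "growth_sum (\<lambda>c. \<Sum>\<phi> \<in> ?P \<rightarrow>\<^sub>E ?V. basis (attach
        ((?F \<phi>)(\<phi> p := add_mset c (?F \<phi> (\<phi> p) - {#fst p#}))) t)) (fst p) =
      growth_sum (\<lambda>c. tree_mult (Node (image_mset (fst(p := c)) (mset_set ?P))) t) (fst p)"
      by (simp only: tree_mult_reindex[OF finite_copies])
  qed simp
  also have "tree_mult (Node (add_mset leaf M)) t + \<dots> = growth_sum (\<lambda>s. tree_mult s t) s"
    by (simp only: growth_sum_forest[of ?P, OF finite_copies, unfolded forest_copies] Node)
  finally show ?thesis .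
qed

section \<open>Coproducts of trees and growth of either tensor factor\<close>

text \<open>The subsets of the enlarged set of children are the old ones, each taken once with and
  once without the new child.\<close>

lemma tree_coprod_add_mset:
  "tree_coprod (Node (add_mset x M)) = (\<Sum>S \<in> Pow (copies M).
    basis (Node (add_mset x (forest S)), Node (forest (copies M - S))) +
    basis (Node (forest S), Node (add_mset x (forest (copies M - S)))))"
proof -
  let ?P = "copies M" and ?q = "(x, count M x)"
  let ?f = "\<lambda>S. basis (Node (forest S), Node (forest (insert ?q ?P - S)))"
  note q = copies_add_mset(2)[of x M]
  have "tree_coprod (Node (add_mset x M)) = sum ?f (Pow ?P) + sum ?f (insert ?q ` Pow ?P)"
    using q by (auto simp: tree_coprod_def copies_add_mset(1) Pow_insert intro!: sum.union_disjoint)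
  also have "sum ?f (insert ?q ` Pow ?P) = (\<Sum>S\<in>Pow ?P. ?f (insert ?q S))"
  proof (subst sum.reindex)
    show "inj_on (insert ?q) (Pow ?P)"
      using q by (intro inj_onI) (metis PowD insert_ident subsetD)
  qed simp
  also have "sum ?f (Pow ?P) =
      (\<Sum>S \<in> Pow ?P. basis (Node (forest S), Node (add_mset x (forest (?P - S)))))"
  proof (rule sum.cong)
    fix S assume "S \<in> Pow ?P"
    then have "insert ?q ?P - S = insert ?q (?P - S)"
      using q by auto
    then show "?f S = basis (Node (forest S), Node (add_mset x (forest (?P - S))))"
      using q by (simp add: forest_insert)
  qed simp
  also have "(\<Sum>S\<in>Pow ?P. ?f (insert ?q S)) =
      (\<Sum>S \<in> Pow ?P. basis (Node (add_mset x (forest S)), Node (forest (?P - S))))"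
  proof (rule sum.cong)
    fix S assume S: "S \<in> Pow ?P"
    then have "insert ?q ?P - insert ?q S = ?P - S" "?q \<notin> S" "finite S"
      using q by (auto intro: finite_subset)
    then show "?f (insert ?q S) = basis (Node (add_mset x (forest S)), Node (forest (?P - S)))"
      by (simp add: forest_insert)
  qed simp
  finally show ?thesis
    by (simp add: sum.distrib add.commute)
qed

lemma coprod_tree_growth:
  "\<Delta> (tree_growth t) = tensor_map id \<N> (tree_coprod t) + tensor_map \<N> id (tree_coprod t)"
proof (cases t)
  case (Node M)
  let ?P = "copies M"
  let ?X = "\<lambda>p c S. Node (image_mset (fst(p := c)) (mset_set S))"
  have fin: "finite S" if "S \<in> Pow ?P" for S
    using that by (auto intro: finite_subset)
  \<comment> \<open>On basis pairs, growing one tensor factor is a \<open>growth_sum\<close> with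
    the other factor held fixed.\<close>
  have left: "tensor_map \<N> id (basis (s, u)) = growth_sum (\<lambda>s. basis (s, u)) s" for s u
    using lin_tree_growth[OF lin_tensor_left[of "basis u"], of s]
    by (simp add: tensor_map_def growth_def)
  have right: "tensor_map id \<N> (basis (s, u)) = growth_sum (\<lambda>u. basis (s, u)) u" for s u
    using lin_tree_growth[OF lin_tensor_right[of "basis s"], of u]
    by (simp add: tensor_map_def growth_def)
  have t: "tree_coprod t = (\<Sum>S\<in>Pow ?P. basis (Node (forest S), Node (forest (?P - S))))"
    by (simp add: tree_coprod_def Node)
  \<comment> \<open>Writing the branches as \<open>forest ?P\<close> keeps \<open>?P\<close> as
    index set when a branch grows, so the coproduct terms are still indexed by the subsets of
    \<open>?P\<close>.\<close>
  have "\<Delta> (tree_growth t) = growth_sum tree_coprod (Node (forest ?P))"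
    by (simp add: lin_tree_growth[OF lin_coprod] Node forest_copies) (simp add: coprod_def)
  also have "\<dots> = tree_coprod (Node (add_mset leaf M)) +
      (\<Sum>p\<in>?P. growth_sum (\<lambda>c. \<Sum>S\<in>Pow ?P. basis (?X p c S, ?X p c (?P - S))) (fst p))"
    by (simp only: growth_sum_forest[OF finite_copies])
      (simp only: forest_copies tree_coprod_reindex[OF finite_copies])
  also have "(\<Sum>p\<in>?P. growth_sum (\<lambda>c. \<Sum>S\<in>Pow ?P. basis (?X p c S, ?X p c (?P - S))) (fst p)) =
      (\<Sum>S\<in>Pow ?P. \<Sum>p\<in>?P. growth_sum (\<lambda>c. basis (?X p c S, ?X p c (?P - S))) (fst p))"
    by (simp add: growth_sum_sum sum.swap[of _ ?P])
  \<comment> \<open>A child \<open>p\<close> lies on exactly one side of the partition; the factor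
    on the other side is unchanged.\<close>
  also have "\<dots> = (\<Sum>S\<in>Pow ?P.
      (\<Sum>p\<in>S. growth_sum (\<lambda>c. basis (?X p c S, Node (forest (?P - S)))) (fst p)) +
      (\<Sum>p\<in>?P - S. growth_sum (\<lambda>c. basis (Node (forest S), ?X p c (?P - S))) (fst p)))"
  proof (rule sum.cong)
    fix S assume S: "S \<in> Pow ?P"
    have "(\<Sum>p\<in>?P. growth_sum (\<lambda>c. basis (?X p c S, ?X p c (?P - S))) (fst p)) =
      (\<Sum>p\<in>S. growth_sum (\<lambda>c. basis (?X p c S, ?X p c (?P - S))) (fst p)) +
      (\<Sum>p\<in>?P - S. growth_sum (\<lambda>c. basis (?X p c S, ?X p c (?P - S))) (fst p))"
      using S by (subst sum.subset_diff[of S ?P]) (auto simp: add.commute)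
    then show "(\<Sum>p\<in>?P. growth_sum (\<lambda>c. basis (?X p c S, ?X p c (?P - S))) (fst p)) =
      (\<Sum>p\<in>S. growth_sum (\<lambda>c. basis (?X p c S, Node (forest (?P - S)))) (fst p)) +
      (\<Sum>p\<in>?P - S. growth_sum (\<lambda>c. basis (Node (forest S), ?X p c (?P - S))) (fst p))"
      using fin[OF S] by (simp add: image_forest_fun_upd cong: sum.cong_simp)
  qed simp
  \<comment> \<open>For every \<open>S\<close>, the leaf term and the branch terms on one side add
    up to the growth of that factor.\<close>
  also have "tree_coprod (Node (add_mset leaf M)) + \<dots> =
      tensor_map id \<N> (tree_coprod t) + tensor_map \<N> id (tree_coprod t)"
    using fin by (simp add: tree_coprod_add_mset t left right growth_sum_forest
        scale.linear_sum[OF lin_tensor_map] sum.distrib add_ac cong: sum.cong_simp)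
  finally show ?thesis .
qed

section \<open>Extension from trees to the algebra, and powers of growth\<close>

lemma unit_mult: "\<e> \<bullet> b = b"
proof (rule lin_eqI[OF lin_mult_right scale.linear_ident])
  show "\<e> \<bullet> basis t = basis t" for t
    by (simp add: unit_gl_def gl_mult_def tree_mult_leaf)
qed

text \<open>Both sides are bilinear, so basis elements suffice, first on the left and then on the
  right; there \<open>growth_tree_mult\<close> applies.\<close>

lemma growth_mult: "\<N> (a \<bullet> b) = \<N> a \<bullet> b"
proof (rule lin_eqI[OF lin_comp[OF lin_mult_left lin_growth] lin_comp[OF lin_growth lin_mult_left]])
  fix s
  show "\<N> (basis s \<bullet> b) = \<N> (basis s) \<bullet> b"
  proof (rule lin_eqI[OF lin_comp[OF lin_mult_right lin_growth] lin_mult_right])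
    fix t
    have "\<N> (basis s) \<bullet> basis t = growth_sum (\<lambda>s. basis s \<bullet> basis t) s"
      using lin_tree_growth[OF lin_mult_left[of "basis t"], of s] by (simp add: growth_def)
    also have "\<dots> = \<N> (basis s \<bullet> basis t)"
      by (simp add: gl_mult_def growth_tree_mult)
    finally show "\<N> (basis s \<bullet> basis t) = \<N> (basis s) \<bullet> basis t" ..
  qed
qed

lemma growth_pow_mult: "(\<N> ^^ k) a \<bullet> b = (\<N> ^^ k) (a \<bullet> b)"
  by (induction k) (simp_all flip: growth_mult)

lemma coprod_growth: "\<Delta> (\<N> b) = tensor_map id \<N> (\<Delta> b) + tensor_map \<N> id (\<Delta> b)"
proof (rule lin_eqI[OF lin_comp[OF lin_growth lin_coprod] scale.linear_compose_add])
  show "lin (\<lambda>b. tensor_map id \<N> (\<Delta> b))" "lin (\<lambda>b. tensor_map \<N> id (\<Delta> b))"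
    by (rule lin_comp[OF lin_coprod lin_tensor_map])+
  show "\<Delta> (\<N> (basis t)) = tensor_map id \<N> (\<Delta> (basis t)) + tensor_map \<N> id (\<Delta> (basis t))" for t
    using coprod_tree_growth[of t] by (simp add: growth_def coprod_def)
qed

theorem proposition2p2:
  shows "(\<forall>b :: 'k::field_char_0 gl. \<N> \<e> \<bullet> b = \<N> b) \<and>
    (\<forall>a b :: 'k gl. \<N> (a \<bullet> b) = \<N> a \<bullet> b) \<and>
    (\<forall>k\<ge>1. \<forall>b :: 'k gl. (\<N> ^^ k) \<e> \<bullet> b = (\<N> ^^ k) b) \<and>
    (\<forall>k\<ge>1. (\<N> ^^ k) \<e> \<bullet> \<N> \<e> = (\<N> ^^ (k + 1)) (\<e> :: 'k gl) \<and>
            (\<N> ^^ (k + 1)) (\<e> :: 'k gl) = \<N> \<e> \<bullet> (\<N> ^^ k) \<e>) \<and>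
    (\<forall>b :: 'k gl. \<Delta> (\<N> b) = tensor_map id \<N> (\<Delta> b) + tensor_map \<N> id (\<Delta> b))"
proof (intro conjI allI impI)
  show 1: "\<N> \<e> \<bullet> b = \<N> b" for b :: "'k gl"
    by (simp add: unit_mult flip: growth_mult)
  show "\<N> (a \<bullet> b) = \<N> a \<bullet> b" for a b :: "'k gl"
    by (rule growth_mult)
  show 3: "(\<N> ^^ k) \<e> \<bullet> b = (\<N> ^^ k) b" for k and b :: "'k gl"
    by (simp add: growth_pow_mult unit_mult)
  \<comment> \<open>By \<open>3\<close> the left side is the power applied to
    \<open>\<N> \<e>\<close>; \<open>funpow_swap1\<close> moves that inner application
    outside.\<close>
  show "(\<N> ^^ k) \<e> \<bullet> \<N> \<e> = (\<N> ^^ (k + 1)) (\<e> :: 'k gl)" for k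
    by (simp add: 3 funpow_swap1)
  show "(\<N> ^^ (k + 1)) (\<e> :: 'k gl) = \<N> \<e> \<bullet> (\<N> ^^ k) \<e>" for k
    by (simp add: 1)
  show "\<Delta> (\<N> b) = tensor_map id \<N> (\<Delta> b) + tensor_map \<N> id (\<Delta> b)" for b :: "'k gl"
    by (rule coprod_growth)
qed

end
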